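(* Let $\ell\ge 2$ be an integer, $0<\lambda<1$, and let $d_1,\dots,d_\ell$ be distinct real numbers. Let $f_j(x)=\lambda x+d_j$ on $\mathbb{R}$ for $1\le j\le \ell$, let $\mu$ be the unique Borel probability measure on $\mathbb{R}$ satisfying $\mu(E)=\sum_{j=1}^{\ell}\frac1\ell\,\mu(f_j^{-1}(E))$ for all Borel sets $E$, and let $K$ be its support, the unique nonempty compact set with $K=\bigcup_{j=1}^{\ell}f_j(K)$. Suppose $\mu$ is absolutely continuous with respect to Lebesgue measure. If $L^2(K,d\mu)$ admits a Fourier frame, then $\lambda=\frac1\ell$, $K$ is a self-similar tile, and the density of $\mu$ is the (normalized) characteristic function of $K$, i.e. $d\mu=\frac{1}{\mathcal{L}(K)}\chi_K\,dx$, where $\mathcal{L}$ denotes Lebesgue measure.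
   Context: $L^2(K,d\mu)$ admits a Fourier frame if there are a countable set $\Lambda\subset\mathbb{R}$ and constants $0<A\le B<\infty$ such that $$A\int|f|^2d\mu\le\sum_{\lambda'\in\Lambda}\Big|\int f(x)e^{-2\pi i\lambda' x}d\mu(x)\Big|^2\le B\int|f|^2d\mu$$ for all $f\in L^2(K,d\mu)$. When $\lambda=1/\ell$ and the compact set $K$ satisfying $K=\bigcup_{j=1}^\ell f_j(K)$ has positive Lebesgue measure, $K$ is called a self-similar tile. *)

theory Defs
  imports "HOL-Probability.Probability"
begin

definition ifs_map :: "real \<Rightarrow> (nat \<Rightarrow> real) \<Rightarrow> nat \<Rightarrow> real \<Rightarrow> real" where
  "ifs_map r d j x = r * x + d j"

definition self_similar_measure ::
  "nat \<Rightarrow> real \<Rightarrow> (nat \<Rightarrow> real) \<Rightarrow> real measure \<Rightarrow> bool" where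
  "self_similar_measure l r d \<mu> \<longleftrightarrow>
     prob_space \<mu> \<and> sets \<mu> = sets borel \<and>
     (\<forall>E\<in>sets borel. measure \<mu> E = (\<Sum>j=1..l. 1 / real l * measure \<mu> (ifs_map r d j -` E)))"

definition measure_support :: "'a::topological_space measure \<Rightarrow> 'a set" where
  "measure_support \<mu> = {x. \<forall>U. open U \<and> x \<in> U \<longrightarrow> emeasure \<mu> U > 0}"

definition square_integrable :: "'a measure \<Rightarrow> ('a \<Rightarrow> complex) \<Rightarrow> bool" where
  "square_integrable M f \<longleftrightarrow> f \<in> borel_measurable M \<and> integrable M (\<lambda>x. (cmod (f x))\<^sup>2)"

definition fourier_coeff :: "real measure \<Rightarrow> (real \<Rightarrow> complex) \<Rightarrow> real \<Rightarrow> complex" where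
  "fourier_coeff M f t =
     (\<integral>x. f x * exp (- 2 * complex_of_real pi * \<i> * complex_of_real t * complex_of_real x) \<partial>M)"

(* The real-valued infsum is 0 on non-summable families, so finiteness of the middle sum,
   which the upper frame bound entails, is required explicitly. *)
definition admits_fourier_frame :: "real measure \<Rightarrow> bool" where
  "admits_fourier_frame M \<longleftrightarrow>
     (\<exists>\<Lambda>::real set. \<exists>A B::real. countable \<Lambda> \<and> 0 < A \<and> A \<le> B \<and>
       (\<forall>f. square_integrable M f \<longrightarrow>
          (\<lambda>t. (cmod (fourier_coeff M f t))\<^sup>2) summable_on \<Lambda> \<and>
          A * (\<integral>x. (cmod (f x))\<^sup>2 \<partial>M) \<le> (\<Sum>\<^sub>\<infinity>t\<in>\<Lambda>. (cmod (fourier_coeff M f t))\<^sup>2) \<and>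
          (\<Sum>\<^sub>\<infinity>t\<in>\<Lambda>. (cmod (fourier_coeff M f t))\<^sup>2) \<le> B * (\<integral>x. (cmod (f x))\<^sup>2 \<partial>M)))"

definition self_similar_tile :: "nat \<Rightarrow> real \<Rightarrow> (nat \<Rightarrow> real) \<Rightarrow> real set \<Rightarrow> bool" where
  "self_similar_tile l r d K \<longleftrightarrow>
     r = 1 / real l \<and> compact K \<and> K = (\<Union>j\<in>{1..l}. ifs_map r d j ` K) \<and> emeasure lborel K > 0"

end

theory Submission
  imports Defs
begin

text \<open>
  Write \<open>g\<close> for the density of \<open>\<mu>\<close>. The functions \<open>h / g\<close> and \<open>h (x - a) / g\<close> in \<open>L\<^sup>2(\<mu>)\<close> have
  Fourier coefficients of equal modulus, because multiplying by \<open>g\<close> turns these coefficients into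
  the Lebesgue Fourier transforms of \<open>h\<close> and of its translate. The frame inequalities therefore
  compare their norms, the integrals of \<open>\<bar>h\<bar>\<^sup>2 / g\<close> and \<open>\<bar>h (x - a)\<bar>\<^sup>2 / g\<close>, with constants that
  do not depend on \<open>h\<close> or \<open>a\<close>. Any two sets of positive Lebesgue measure overlap after a translation,
  so \<open>g\<close> cannot take both a value of fixed size and arbitrarily small positive values on sets of
  positive measure: on the set where it is positive, \<open>g\<close> is essentially bounded below
  (\<open>frame_density_bounded_below\<close>).

  The lower bound decides the contraction ratio. Since the translations are distinct, exactly one map
  \<open>f\<^sub>i\<close> fixes the left end point \<open>a\<close> of \<open>K\<close>, and no other piece of \<open>K\<close> reaches close to \<open>a\<close>. Applying
  \<open>f\<^sub>i\<close> repeatedly shrinks a one-sided neighbourhood of \<open>a\<close> in Lebesgue measure by \<open>r\<close> and in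
  \<open>\<mu>\<close>-measure by \<open>1 / l\<close> at each step. If \<open>r l > 1\<close>, the average density near \<open>a\<close> tends to zero,
  contrary to the lower bound (\<open>ratio_le_if_density_bounded_below\<close>). Conversely \<open>K\<close> has positive
  Lebesgue measure and is covered by \<open>l\<close> copies of itself scaled by \<open>r\<close>, so \<open>r l \<ge> 1\<close>.

  Once \<open>r = 1 / l\<close>, this covering wastes no measure, and so the uniform measure on \<open>K\<close> satisfies
  the self-similarity equation of \<open>\<mu>\<close> (\<open>self_similar_measure_uniform\<close>). That equation has only one
  solution (\<open>self_similar_measure_unique\<close>): it relates the characteristic function at \<open>t\<close> to its
  value at \<open>r t\<close>, hence to its value near \<open>0\<close>. So \<open>\<mu>\<close> is the uniform measure on \<open>K\<close>.
\<close>

section \<open>Fourier frames of absolutely continuous measures\<close>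

text \<open>
  The frequency set and the two bounds are parameters because they have to be the same for a function
  and for its translate.
\<close>

definition frame_bounds :: "real measure \<Rightarrow> real set \<Rightarrow> real \<Rightarrow> real \<Rightarrow> bool" where
  "frame_bounds M \<Lambda> A B \<longleftrightarrow> 0 < A \<and> A \<le> B \<and>
     (\<forall>f. square_integrable M f \<longrightarrow>
          A * (\<integral>x. (cmod (f x))\<^sup>2 \<partial>M) \<le> (\<Sum>\<^sub>\<infinity>t\<in>\<Lambda>. (cmod (fourier_coeff M f t))\<^sup>2) \<and>
          (\<Sum>\<^sub>\<infinity>t\<in>\<Lambda>. (cmod (fourier_coeff M f t))\<^sup>2) \<le> B * (\<integral>x. (cmod (f x))\<^sup>2 \<partial>M))"

text \<open>
  The complement of \<open>K\<close> is a null set, so integrals over the restricted space are integrals over the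
  whole line.
\<close>

lemma admits_fourier_frame_restrict_space:
  assumes frame: "admits_fourier_frame (restrict_space M K)"
    and sets_M: "sets M = sets borel"
    and K: "K \<in> sets borel" and AE_K: "AE x in M. x \<in> K"
  obtains \<Lambda> A B where "frame_bounds M \<Lambda> A B"
proof -
  let ?R = "restrict_space M K"
  obtain \<Lambda> A B where AB: "0 < A" "A \<le> B" and
    bounds: "\<And>f. square_integrable ?R f \<Longrightarrow>
          A * (\<integral>x. (cmod (f x))\<^sup>2 \<partial>?R) \<le> (\<Sum>\<^sub>\<infinity>t\<in>\<Lambda>. (cmod (fourier_coeff ?R f t))\<^sup>2) \<and>
          (\<Sum>\<^sub>\<infinity>t\<in>\<Lambda>. (cmod (fourier_coeff ?R f t))\<^sup>2) \<le> B * (\<integral>x. (cmod (f x))\<^sup>2 \<partial>?R)"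
    using frame unfolding admits_fourier_frame_def by blast
  have KM: "K \<inter> space M \<in> sets M"
    using K sets_M sets_eq_imp_space_eq[OF sets_M] by auto
  have integral_R: "(\<integral>x. h x \<partial>?R) = (\<integral>x. h x \<partial>M)" if "h \<in> borel_measurable M"
    for h :: "real \<Rightarrow> 'b::{banach, second_countable_topology}"
  proof -
    have "(\<lambda>x. indicator K x *\<^sub>R h x) \<in> borel_measurable M"
      using that K by (intro borel_measurable_scaleR borel_measurable_indicator) (auto simp: sets_M)
    then show ?thesis
      unfolding integral_restrict_space[OF KM]
      by (intro integral_cong_AE that eventually_mono[OF AE_K]) (auto simp: indicator_def)
  qed
  have "frame_bounds M \<Lambda> A B"
    unfolding frame_bounds_def
  proof (intro conjI allI impI AB)
    fix f assume f: "square_integrable M f"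
    have [measurable]: "f \<in> borel_measurable M"
      using f by (simp add: square_integrable_def)
    have [measurable_cong]: "sets M = sets borel" by fact
    have "integrable ?R (\<lambda>x. (cmod (f x))\<^sup>2)"
      using f K unfolding integrable_restrict_space[OF KM] square_integrable_def
      by (intro integrable_mult_indicator) (auto simp: sets_M)
    then have fR: "square_integrable ?R f"
      by (simp add: square_integrable_def measurable_restrict_space1)
    have [simp]: "fourier_coeff ?R f t = fourier_coeff M f t" for t
      unfolding fourier_coeff_def by (rule integral_R) measurable
    have [simp]: "(\<integral>x. (cmod (f x))\<^sup>2 \<partial>?R) = (\<integral>x. (cmod (f x))\<^sup>2 \<partial>M)"
      by (rule integral_R) measurable
    show "A * (\<integral>x. (cmod (f x))\<^sup>2 \<partial>M) \<le> (\<Sum>\<^sub>\<infinity>t\<in>\<Lambda>. (cmod (fourier_coeff M f t))\<^sup>2)"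
      and "(\<Sum>\<^sub>\<infinity>t\<in>\<Lambda>. (cmod (fourier_coeff M f t))\<^sup>2) \<le> B * (\<integral>x. (cmod (f x))\<^sup>2 \<partial>M)"
      using bounds[OF fR] by simp_all
  qed
  then show ?thesis by (rule that)
qed

text \<open>
  By Tonelli, the measure of the overlap, integrated over all translations \<open>a\<close>, is the product of the
  measures of \<open>P\<close> and \<open>Q\<close>.
\<close>

lemma positive_measure_translate_overlap:
  fixes P Q :: "real set"
  assumes [measurable]: "P \<in> sets borel" "Q \<in> sets borel"
    and P: "emeasure lborel P > 0" and Q: "emeasure lborel Q > 0"
  obtains a where "emeasure lborel {x \<in> Q. a + x \<in> P} > 0"
proof -
  have "(\<integral>\<^sup>+a. emeasure lborel {x \<in> Q. a + x \<in> P} \<partial>lborel)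
      = (\<integral>\<^sup>+a. \<integral>\<^sup>+x. indicator Q x * indicator P (a + x) \<partial>lborel \<partial>lborel)"
  proof (rule nn_integral_cong)
    fix a :: real
    have "emeasure lborel {x \<in> Q. a + x \<in> P} = (\<integral>\<^sup>+x. indicator {x \<in> Q. a + x \<in> P} x \<partial>lborel)"
      by simp
    also have "\<dots> = (\<integral>\<^sup>+x. indicator Q x * indicator P (a + x) \<partial>lborel)"
      by (intro nn_integral_cong) (simp add: indicator_def)
    finally show "emeasure lborel {x \<in> Q. a + x \<in> P}
      = (\<integral>\<^sup>+x. indicator Q x * indicator P (a + x) \<partial>lborel)" .
  qed
  also have "\<dots> = (\<integral>\<^sup>+x. \<integral>\<^sup>+a. indicator Q x * indicator P (a + x) \<partial>lborel \<partial>lborel)"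
    by (rule lborel_pair.Fubini') measurable
  also have "\<dots> = (\<integral>\<^sup>+x. indicator Q x * emeasure lborel P \<partial>lborel)"
  proof (rule nn_integral_cong)
    fix x :: real
    have "(\<integral>\<^sup>+a. indicator P (a + x) \<partial>lborel) = emeasure lborel P"
      using nn_integral_real_affine[of "indicator P :: real \<Rightarrow> ennreal" 1 x]
      by (simp add: add.commute)
    then show "(\<integral>\<^sup>+a. indicator Q x * indicator P (a + x) \<partial>lborel)
             = indicator Q x * emeasure lborel P"
      by (subst nn_integral_cmult) auto
  qed
  also have "\<dots> = emeasure lborel Q * emeasure lborel P"
    by (simp add: nn_integral_multc)
  also have "\<dots> > 0"
    using P Q by (simp add: ennreal_zero_less_mult_iff)
  finally have pos: "(\<integral>\<^sup>+a. emeasure lborel {x \<in> Q. a + x \<in> P} \<partial>lborel) > 0" .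
  have "\<exists>a. emeasure lborel {x \<in> Q. a + x \<in> P} \<noteq> 0"
  proof (rule ccontr)
    assume "\<not> ?thesis"
    then show False using pos by simp
  qed
  then show ?thesis
    using that by (auto simp: zero_less_iff_neq_zero)
qed

text \<open>
  The test function \<open>1 / g\<close> on \<open>S\<close> cancels the density: its Fourier coefficients with respect to the
  measure of density \<open>g\<close> are the Lebesgue Fourier transform of the indicator of \<open>S\<close>, while its norm
  records the size of \<open>g\<close> on \<open>S\<close>.
\<close>

lemma
  fixes g :: "real \<Rightarrow> real" and S :: "real set"
  defines "M \<equiv> density lborel (\<lambda>x. ennreal (g x))"
    and "f \<equiv> (\<lambda>x. complex_of_real (indicator S x / g x))"
  assumes [measurable]: "g \<in> borel_measurable borel" "S \<in> sets borel"
    and g0: "\<And>x. 0 \<le> g x"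
    and fin: "emeasure lborel S < \<infinity>"
    and c: "0 < c" "\<And>x. x \<in> S \<Longrightarrow> c \<le> g x"
  shows square_integrable_reciprocal_density: "square_integrable M f"
    and integral_reciprocal_density_le: "(\<integral>x. (cmod (f x))\<^sup>2 \<partial>M) \<le> measure lborel S / c"
    and integral_reciprocal_density_ge:
      "(\<And>x. x \<in> S \<Longrightarrow> g x \<le> C) \<Longrightarrow> measure lborel S / C \<le> (\<integral>x. (cmod (f x))\<^sup>2 \<partial>M)"
    and fourier_coeff_reciprocal_density:
      "fourier_coeff M f t = (\<integral>x. indicator S x *\<^sub>R
         exp (- 2 * complex_of_real pi * \<i> * complex_of_real t * complex_of_real x) \<partial>lborel)"
proof -
  have gpos: "g x > 0" if "x \<in> S" for x using c that by force
  have meas: "f \<in> borel_measurable lborel" unfolding f_def by measurable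
  have sq: "g x *\<^sub>R (cmod (f x))\<^sup>2 = indicator S x / g x" for x
    using gpos[of x] by (auto simp: f_def indicator_def power2_eq_square norm_divide)
  have int1: "integrable lborel (\<lambda>x. indicator S x / k)" for k :: real
    using fin by (intro integrable_divide_zero) (auto simp: integrable_indicator_iff)
  have int: "integrable lborel (\<lambda>x. indicator S x / g x)"
  proof (rule Bochner_Integration.integrable_bound[OF int1[of c]])
    show "AE x in lborel. norm (indicator S x / g x) \<le> norm (indicator S x / c)"
      using c gpos by (auto simp: indicator_def intro!: AE_I2 frac_le order_trans[OF c(2) abs_ge_self])
  qed simp
  have norm_f: "(\<integral>x. (cmod (f x))\<^sup>2 \<partial>M) = (\<integral>x. indicator S x / g x \<partial>lborel)"
    using meas unfolding M_def by (subst integral_density) (auto simp: g0 sq simp del: real_scaleR_def)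
  show "square_integrable M f"
    using meas int unfolding square_integrable_def M_def
    by (subst integrable_density) (auto simp: g0 sq simp del: real_scaleR_def)
  have "(\<integral>x. indicator S x / g x \<partial>lborel) \<le> (\<integral>x. indicator S x / c \<partial>lborel)"
    using c by (intro integral_mono int int1) (auto simp: indicator_def frac_le)
  then show "(\<integral>x. (cmod (f x))\<^sup>2 \<partial>M) \<le> measure lborel S / c"
    by (simp add: norm_f)
  show "measure lborel S / C \<le> (\<integral>x. (cmod (f x))\<^sup>2 \<partial>M)" if C: "\<And>x. x \<in> S \<Longrightarrow> g x \<le> C"
  proof -
    have "(\<integral>x. indicator S x / C \<partial>lborel) \<le> (\<integral>x. indicator S x / g x \<partial>lborel)"
      using C gpos by (intro integral_mono int int1) (auto simp: indicator_def frac_le)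
    then show ?thesis by (simp add: norm_f)
  qed
  have "g x *\<^sub>R (f x * e) = indicator S x *\<^sub>R e" for x e
    using gpos[of x] by (auto simp: f_def indicator_def scaleR_conv_of_real)
  then show "fourier_coeff M f t = (\<integral>x. indicator S x *\<^sub>R
         exp (- 2 * complex_of_real pi * \<i> * complex_of_real t * complex_of_real x) \<partial>lborel)"
    using meas unfolding fourier_coeff_def M_def
    by (subst integral_density) (auto simp: g0)
qed

text \<open>
  The sums in the frame inequalities agree for \<open>S\<close> and for its translate \<open>a + S\<close>, as a translation
  only changes the phase of the Fourier transform. The lower frame bound for \<open>S\<close> and the upper one for
  \<open>a + S\<close> then compare the integrals of \<open>1 / g\<close> over the two sets.
\<close>

lemma frame_density_translate_ratio:
  fixes g :: "real \<Rightarrow> real"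
  assumes frame: "frame_bounds (density lborel (\<lambda>x. ennreal (g x))) \<Lambda> A B"
    and [measurable]: "g \<in> borel_measurable borel" "S \<in> sets borel"
    and g0: "\<And>x. 0 \<le> g x"
    and S: "emeasure lborel S > 0" "emeasure lborel S < \<infinity>"
    and c: "0 < c" "\<And>x. x \<in> S \<Longrightarrow> c \<le> g x"
    and q: "\<And>x. x \<in> S \<Longrightarrow> g x \<le> q"
    and p: "0 < p" "\<And>x. x \<in> S \<Longrightarrow> p \<le> g (a + x)"
  shows "A * p \<le> B * q"
proof -
  let ?M = "density lborel (\<lambda>x. ennreal (g x))"
  let ?e = "\<lambda>t x. exp (- 2 * complex_of_real pi * \<i> * complex_of_real t * complex_of_real x)"
  define T where "T = (\<lambda>x. x - a) -` S"
  have [measurable]: "T \<in> sets borel"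
    unfolding T_def by (rule measurable_sets_borel[OF _ \<open>S \<in> sets borel\<close>]) measurable
  have indT: "indicator T (a + x) = indicator S x" for x
    by (simp add: T_def indicator_def)
  have emT: "emeasure lborel T = emeasure lborel S"
    using nn_integral_real_affine[of "indicator T :: real \<Rightarrow> ennreal" 1 a]
    by (simp add: indT)
  have mT: "measure lborel T = measure lborel S" by (simp add: measure_def emT)
  have pT: "p \<le> g x" if "x \<in> T" for x
    using p(2)[of "x - a"] that by (simp add: T_def)
  let ?f = "\<lambda>S x. complex_of_real (indicator S x / g x)"
  have coeff: "cmod (fourier_coeff ?M (?f T) t) = cmod (fourier_coeff ?M (?f S) t)" for t
  proof -
    have "fourier_coeff ?M (?f T) t = (\<integral>x. indicator T x *\<^sub>R ?e t x \<partial>lborel)"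
      by (rule fourier_coeff_reciprocal_density[OF _ _ g0 _ p(1) pT]) (use S emT in auto)
    also have "\<dots> = (\<integral>x. indicator S x *\<^sub>R ?e t (a + x) \<partial>lborel)"
      by (subst lborel_integral_real_affine[of 1 _ a]) (auto simp: indT)
    also have "\<dots> = (\<integral>x. ?e t a * (indicator S x *\<^sub>R ?e t x) \<partial>lborel)"
      by (intro Bochner_Integration.integral_cong refl)
         (auto simp: indicator_def exp_add[symmetric] algebra_simps)
    also have "\<dots> = ?e t a * (\<integral>x. indicator S x *\<^sub>R ?e t x \<partial>lborel)"
      by (rule integral_mult_right_zero)
    also have "(\<integral>x. indicator S x *\<^sub>R ?e t x \<partial>lborel) = fourier_coeff ?M (?f S) t"
      by (rule fourier_coeff_reciprocal_density[OF _ _ g0 S(2) c, symmetric]) auto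
    finally show ?thesis
      by (simp add: norm_mult)
  qed
  have q0: "0 < q"
  proof -
    obtain x where "x \<in> S" using S(1) by (metis emeasure_empty equals0I less_irrefl)
    then show ?thesis using c q by force
  qed
  have B0: "0 < A" "0 < B" using frame by (auto simp: frame_bounds_def)
  have mS: "0 < measure lborel S"
    using S by (simp add: measure_def enn2real_positive_iff)
  have "A * (measure lborel S / q) \<le> A * (\<integral>x. (cmod (?f S x))\<^sup>2 \<partial>?M)"
    using B0 q by (intro mult_left_mono integral_reciprocal_density_ge[OF _ _ g0 S(2) c]) auto
  also have "\<dots> \<le> (\<Sum>\<^sub>\<infinity>t\<in>\<Lambda>. (cmod (fourier_coeff ?M (?f S) t))\<^sup>2)"
    using frame square_integrable_reciprocal_density[OF _ _ g0 S(2) c]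
    by (auto simp: frame_bounds_def)
  also have "\<dots> = (\<Sum>\<^sub>\<infinity>t\<in>\<Lambda>. (cmod (fourier_coeff ?M (?f T) t))\<^sup>2)"
    by (simp only: coeff)
  also have "\<dots> \<le> B * (\<integral>x. (cmod (?f T x))\<^sup>2 \<partial>?M)"
    using frame square_integrable_reciprocal_density[OF _ _ g0 _ p(1) pT] S emT
    by (auto simp: frame_bounds_def)
  also have "\<dots> \<le> B * (measure lborel T / p)"
    using B0 S emT by (intro mult_left_mono integral_reciprocal_density_le[OF _ _ g0 _ p(1) pT]) auto
  finally have "measure lborel S * (A / q) \<le> measure lborel S * (B / p)"
    by (simp add: mT mult_ac)
  then have "A / q \<le> B / p"
    using mS by (simp only: mult_le_cancel_left_pos)
  then show ?thesis using p q0 by (simp add: field_simps)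
qed

lemma emeasure_positive_part_approx:
  fixes g :: "real \<Rightarrow> real"
  assumes [measurable]: "g \<in> borel_measurable borel" "X \<in> sets borel"
    and "emeasure lborel {x \<in> X. 0 < g x} > 0"
  obtains p where "0 < p" "emeasure lborel {x \<in> X. p \<le> g x} > 0"
proof (rule ccontr)
  assume *: "\<not> thesis"
  have "emeasure lborel (\<Union>n. {x \<in> X. 1 / real (Suc n) \<le> g x}) = 0"
  proof (rule emeasure_UN_eq_0)
    show "emeasure lborel {x \<in> X. 1 / real (Suc n) \<le> g x} = 0" for n
      using that[of "1 / real (Suc n)"] * by (auto simp: zero_less_iff_neq_zero)
  qed auto
  moreover have "(\<Union>n. {x \<in> X. 1 / real (Suc n) \<le> g x}) = {x \<in> X. 0 < g x}"
  proof safe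
    fix x n assume "1 / real (Suc n) \<le> g x"
    then show "0 < g x" by (rule less_le_trans[rotated]) simp
  next
    fix x assume "x \<in> X" "0 < g x"
    then show "x \<in> (\<Union>n. {x \<in> X. 1 / real (Suc n) \<le> g x})"
      using nat_approx_posE[of "g x"] by (auto intro: less_imp_le)
  qed
  ultimately show False using assms by simp
qed

lemma emeasure_superlevel_density_finite:
  fixes g :: "real \<Rightarrow> real"
  assumes "prob_space (density lborel (\<lambda>x. ennreal (g x)))"
    and [measurable]: "g \<in> borel_measurable borel" and "0 < c"
  shows "emeasure lborel {x. c \<le> g x} < \<infinity>"
proof -
  let ?M = "density lborel (\<lambda>x. ennreal (g x))"
  interpret prob_space ?M by fact
  have "ennreal c * emeasure lborel {x. c \<le> g x}
      = (\<integral>\<^sup>+x. ennreal c * indicator {x. c \<le> g x} x \<partial>lborel)"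
    by (simp add: nn_integral_cmult)
  also have "\<dots> \<le> (\<integral>\<^sup>+x\<in>{x. c \<le> g x}. ennreal (g x) \<partial>lborel)"
    by (intro nn_integral_mono) (auto simp: indicator_def ennreal_leI)
  also have "\<dots> = emeasure ?M {x. c \<le> g x}"
    by (simp add: emeasure_density)
  finally have "ennreal c * emeasure lborel {x. c \<le> g x} \<le> 1"
    using order_trans measure_le_1 by blast
  then show ?thesis using \<open>0 < c\<close>
    by (cases "emeasure lborel {x. c \<le> g x} = top") (auto simp: ennreal_mult_top less_top top_unique)
qed

text \<open>
  If \<open>g \<ge> p\<close> on a set of positive measure and \<open>0 < g < q\<close> on another one, some translate of the
  second meets the first in positive measure, and the translation estimate forces \<open>A p \<le> B q\<close>.
\<close>

proposition frame_density_bounded_below: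
  fixes g :: "real \<Rightarrow> real"
  assumes frame: "frame_bounds (density lborel (\<lambda>x. ennreal (g x))) \<Lambda> A B"
    and prob: "prob_space (density lborel (\<lambda>x. ennreal (g x)))"
    and [measurable]: "g \<in> borel_measurable borel"
    and g0: "\<And>x. 0 \<le> g x"
  obtains q where "0 < q" "AE x in lborel. g x = 0 \<or> q \<le> g x"
proof -
  let ?M = "density lborel (\<lambda>x. ennreal (g x))"
  have "emeasure lborel {x \<in> UNIV. 0 < g x} > 0"
  proof (rule ccontr)
    assume "\<not> ?thesis"
    then have "emeasure lborel {x. 0 < g x} = 0" by (simp add: zero_less_iff_neq_zero)
    then have "AE x in lborel. \<not> 0 < g x" by (subst AE_iff_measurable[OF _ refl]) auto
    then have "AE x in lborel. ennreal (g x) = 0" by eventually_elim (simp add: ennreal_neg)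
    then have "emeasure ?M (space ?M) = 0"
      by (simp add: emeasure_density nn_integral_0_iff_AE)
    then show False using prob_space.emeasure_space_1[OF prob] by simp
  qed
  then obtain p where p: "0 < p" "emeasure lborel {x \<in> UNIV. p \<le> g x} > 0"
    using emeasure_positive_part_approx[of g UNIV] by auto
  have AB: "0 < A" "0 < B" using frame by (auto simp: frame_bounds_def)
  \<comment> \<open>Half of the threshold \<open>A p / B\<close>, so that \<open>A p \<le> B q\<close> is impossible.\<close>
  define q where "q = A * p / (2 * B)"
  have q: "0 < q" using AB p by (simp add: q_def)
  have "emeasure lborel {x \<in> {x. g x < q}. 0 < g x} = 0"
  proof (rule ccontr)
    assume "\<not> ?thesis"
    then obtain c where c: "0 < c" "emeasure lborel {x \<in> {x. g x < q}. c \<le> g x} > 0"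
      using emeasure_positive_part_approx[of g "{x. g x < q}"] by (auto simp: zero_less_iff_neq_zero)
    define P where "P = {x \<in> UNIV. p \<le> g x}"
    define Q where "Q = {x \<in> {x. g x < q}. c \<le> g x}"
    have [measurable]: "P \<in> sets borel" "Q \<in> sets borel" by (auto simp: P_def Q_def)
    obtain a where a: "emeasure lborel {x \<in> Q. a + x \<in> P} > 0"
      using positive_measure_translate_overlap[of P Q] p c by (auto simp: P_def Q_def)
    have "emeasure lborel {x \<in> Q. a + x \<in> P} \<le> emeasure lborel {x. c \<le> g x}"
      by (rule emeasure_mono) (auto simp: Q_def)
    also have "\<dots> < \<infinity>" by (rule emeasure_superlevel_density_finite[OF prob _ c(1)]) measurable
    finally have fin: "emeasure lborel {x \<in> Q. a + x \<in> P} < \<infinity>" .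
    have "A * p \<le> B * q"
      by (rule frame_density_translate_ratio[OF frame _ _ g0 a fin c(1) _ _ p(1)])
         (auto simp: P_def Q_def)
    then show False using AB p by (simp add: q_def field_simps)
  qed
  then have "AE x in lborel. \<not> (g x < q \<and> 0 < g x)"
    by (subst AE_iff_measurable[OF _ refl]) auto
  then have "AE x in lborel. g x = 0 \<or> q \<le> g x"
  proof eventually_elim
    fix x assume "\<not> (g x < q \<and> 0 < g x)"
    then show "g x = 0 \<or> q \<le> g x" using g0[of x] by linarith
  qed
  then show ?thesis using q that by blast
qed

section \<open>Supports of measures\<close>

lemma closed_measure_support: "closed (measure_support M)"
  unfolding closed_def open_subopen[of "- measure_support M"]
  by (fastforce simp: measure_support_def)

lemma disjnt_measure_support:
  "open U \<Longrightarrow> emeasure M U = 0 \<Longrightarrow> U \<inter> measure_support M = {}"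
  by (auto simp: measure_support_def)

text \<open>
  The complement of the support is a union of open null sets; second countability (Lindelof) reduces
  it to a countable union.
\<close>

lemma AE_in_measure_support:
  fixes M :: "'a::second_countable_topology measure"
  assumes sets_M: "sets M = sets borel"
  shows "AE x in M. x \<in> measure_support M"
proof -
  let ?\<F> = "{U. open U \<and> emeasure M U = 0}"
  obtain \<F> where \<F>: "\<F> \<subseteq> ?\<F>" "countable \<F>" "\<Union>\<F> = \<Union>?\<F>"
    by (rule Lindelof[of ?\<F>]) auto
  have "(\<Union>U\<in>\<F>. U) \<in> null_sets M"
    using \<F>(1,2) by (intro null_sets_UN') (auto simp: null_sets_def sets_M)
  moreover have "{x \<in> space M. x \<notin> measure_support M} \<subseteq> (\<Union>U\<in>\<F>. U)"
    using \<F>(3) by (auto simp: measure_support_def zero_less_iff_neq_zero)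
  ultimately show ?thesis by (rule AE_I')
qed

section \<open>Self-similar measures\<close>

lemma measurable_ifs_map [measurable]: "ifs_map r d j \<in> borel_measurable borel"
  unfolding ifs_map_def by measurable

lemma vimage_ifs_map_in_borel [measurable]: "E \<in> sets borel \<Longrightarrow> ifs_map r d j -` E \<in> sets borel"
  using measurable_sets_borel[OF measurable_ifs_map] by blast

lemma emeasure_lborel_vimage_ifs_map:
  assumes "0 < r" and [measurable]: "E \<in> sets borel"
  shows "emeasure lborel E = ennreal r * emeasure lborel (ifs_map r d j -` E)"
proof -
  have "emeasure lborel E = (\<integral>\<^sup>+x. indicator E x \<partial>lborel)" by simp
  also have "\<dots> = ennreal r * (\<integral>\<^sup>+x. indicator E (d j + r * x) \<partial>lborel)"
    using \<open>0 < r\<close> by (subst nn_integral_real_affine[of _ r "d j"]) auto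
  also have "(\<lambda>x. indicator E (d j + r * x)) = (indicator (ifs_map r d j -` E) :: real \<Rightarrow> ennreal)"
    by (auto simp: indicator_def ifs_map_def add.commute)
  finally show ?thesis by simp
qed

locale self_similar =
  fixes l :: nat and r :: real and d :: "nat \<Rightarrow> real" and \<mu> :: "real measure"
  assumes l_pos: "1 \<le> l" and r_pos: "0 < r" and r_less_1: "r < 1"
    and self_similar_measure: "self_similar_measure l r d \<mu>"

sublocale self_similar \<subseteq> real_distribution \<mu>
  using self_similar_measure
  by (auto simp: self_similar_measure_def real_distribution_def real_distribution_axioms_def)

context self_similar
begin

lemma prob_eq_sum:
  "E \<in> sets borel \<Longrightarrow> prob E = (\<Sum>j=1..l. 1 / real l * prob (ifs_map r d j -` E))"
  using self_similar_measure by (simp add: self_similar_measure_def)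

lemma prob_eq_0_iff:
  assumes "E \<in> sets borel"
  shows "prob E = 0 \<longleftrightarrow> (\<forall>j\<in>{1..l}. prob (ifs_map r d j -` E) = 0)"
  unfolding prob_eq_sum[OF assms] using l_pos
  by (subst sum_nonneg_eq_0_iff) (auto simp: measure_nonneg)

text \<open>
  The law of a random map, chosen uniformly among the \<open>f\<^sub>j\<close>, applied to an independent point with law
  \<open>\<mu>\<close> is again \<open>\<mu>\<close>. In this form the defining identity for sets passes to integrals by Fubini.
\<close>

lemma self_similar_as_mixture:
  "\<mu> = distr (measure_pmf (pmf_of_set {1..l}) \<Otimes>\<^sub>M \<mu>) borel (\<lambda>(j, x). ifs_map r d j x)"
    (is "_ = distr ?P _ ?h")
proof (rule measure_eqI)
  have [measurable]: "?h \<in> borel_measurable ?P"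
    unfolding ifs_map_def by measurable
  fix E assume "E \<in> sets \<mu>"
  then have E[measurable]: "E \<in> sets borel" by simp
  have "emeasure (distr ?P borel ?h) E = emeasure ?P (?h -` E \<inter> space ?P)"
    by (rule emeasure_distr) measurable
  also have "\<dots> = (\<integral>\<^sup>+j. emeasure \<mu> (Pair j -` (?h -` E \<inter> space ?P)) \<partial>measure_pmf (pmf_of_set {1..l}))"
    by (rule emeasure_pair_measure_alt) measurable
  also have "\<dots> = (\<integral>\<^sup>+j. emeasure \<mu> (ifs_map r d j -` E) \<partial>measure_pmf (pmf_of_set {1..l}))"
    by (intro nn_integral_cong arg_cong[where f="emeasure \<mu>"]) (auto simp: space_pair_measure)
  also have "\<dots> = ennreal (prob E)"
    using l_pos unfolding prob_eq_sum[OF E]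
    by (simp add: nn_integral_pmf_of_set emeasure_eq_measure sum_divide_distrib[symmetric]
        sum_ennreal measure_nonneg divide_ennreal sum_nonneg ennreal_of_nat_eq_real_of_nat)
  finally show "emeasure \<mu> E = emeasure (distr ?P borel ?h) E"
    by (simp add: emeasure_eq_measure)
qed simp

lemma integral_eq_sum:
  fixes h :: "real \<Rightarrow> 'b::{banach, second_countable_topology}"
  assumes [measurable]: "h \<in> borel_measurable borel" and bounded: "\<And>x. norm (h x) \<le> C"
  shows "(\<integral>x. h x \<partial>\<mu>) = (\<Sum>j=1..l. (1 / real l) *\<^sub>R (\<integral>x. h (ifs_map r d j x) \<partial>\<mu>))"
proof -
  let ?p = "measure_pmf (pmf_of_set {1..l})"
  interpret P: pair_prob_space ?p \<mu> ..
  have [measurable]: "(\<lambda>(j, x). ifs_map r d j x) \<in> borel_measurable (?p \<Otimes>\<^sub>M \<mu>)"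
    unfolding ifs_map_def by measurable
  have "(\<integral>x. h x \<partial>\<mu>) = (\<integral>z. h (case z of (j, x) \<Rightarrow> ifs_map r d j x) \<partial>(?p \<Otimes>\<^sub>M \<mu>))"
    by (subst self_similar_as_mixture, subst integral_distr) measurable
  also have "\<dots> = (\<integral>j. \<integral>x. h (ifs_map r d j x) \<partial>\<mu> \<partial>?p)"
  proof (subst P.integral_fst'[symmetric])
    show "integrable (?p \<Otimes>\<^sub>M \<mu>) (\<lambda>z. h (case z of (j, x) \<Rightarrow> ifs_map r d j x))"
      by (rule P.P.integrable_const_bound[of _ C]) (auto simp: bounded)
  qed simp
  also have "\<dots> = (\<Sum>j\<in>{1..l}. pmf (pmf_of_set {1..l}) j *\<^sub>R (\<integral>x. h (ifs_map r d j x) \<partial>\<mu>))"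
    using l_pos by (intro integral_measure_pmf) auto
  also have "\<dots> = (\<Sum>j=1..l. (1 / real l) *\<^sub>R (\<integral>x. h (ifs_map r d j x) \<partial>\<mu>))"
    using l_pos by (intro sum.cong) auto
  finally show ?thesis .
qed

lemma char_eq_sum:
  "char \<mu> t = (\<Sum>j=1..l. (1 / real l) *\<^sub>R (iexp (t * d j) * char \<mu> (r * t)))"
proof -
  have "char \<mu> t = (\<Sum>j=1..l. (1 / real l) *\<^sub>R (\<integral>x. iexp (t * ifs_map r d j x) \<partial>\<mu>))"
    unfolding char_def by (rule integral_eq_sum[where C=1]) auto
  also have "\<dots> = (\<Sum>j=1..l. (1 / real l) *\<^sub>R (iexp (t * d j) * char \<mu> (r * t)))"
  proof (intro sum.cong refl arg_cong[where f="\<lambda>z. (1 / real l) *\<^sub>R z"])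
    fix j
    have "(\<integral>x. iexp (t * ifs_map r d j x) \<partial>\<mu>) = (\<integral>x. iexp (t * d j) * iexp (r * t * x) \<partial>\<mu>)"
      by (intro Bochner_Integration.integral_cong refl)
         (simp add: ifs_map_def exp_add[symmetric] algebra_simps)
    then show "(\<integral>x. iexp (t * ifs_map r d j x) \<partial>\<mu>) = iexp (t * d j) * char \<mu> (r * t)"
      by (simp add: char_def)
  qed
  finally show ?thesis .
qed

end

text \<open>
  The difference of the two characteristic functions at \<open>t\<close> is bounded by their difference at
  \<open>r t\<close>, hence at \<open>r\<^sup>n t\<close>, which tends to zero because both are continuous at \<open>0\<close> with value \<open>1\<close>.
\<close>

theorem self_similar_measure_unique:
  assumes "self_similar l r d M" "self_similar l r d N"
  shows "M = N"
proof (rule Levy_uniqueness)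
  interpret M: self_similar l r d M by fact
  interpret N: self_similar l r d N by fact
  show "real_distribution M" "real_distribution N" by unfold_locales
  have step: "cmod (char M t - char N t) \<le> cmod (char M (r * t) - char N (r * t))" for t
  proof -
    have "char M t - char N t =
      (\<Sum>j=1..l. (1 / real l) *\<^sub>R (iexp (t * d j) * (char M (r * t) - char N (r * t))))"
      unfolding M.char_eq_sum[of t] N.char_eq_sum[of t]
      by (simp add: sum_subtractf algebra_simps)
    also have "cmod \<dots> \<le> (\<Sum>j=1..l. (1 / real l) * cmod (char M (r * t) - char N (r * t)))"
      by (rule sum_norm_le) (simp add: norm_mult)
    also have "\<dots> = cmod (char M (r * t) - char N (r * t))"
      using M.l_pos by simp
    finally show ?thesis .
  qed
  have iter: "cmod (char M t - char N t) \<le> cmod (char M (r ^ n * t) - char N (r ^ n * t))" for n t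
  proof (induction n)
    case (Suc n)
    also have "cmod (char M (r ^ n * t) - char N (r ^ n * t))
      \<le> cmod (char M (r ^ Suc n * t) - char N (r ^ Suc n * t))"
      using step[of "r ^ n * t"] by (simp add: mult.assoc)
    finally show ?case .
  qed simp
  show "char M = char N"
  proof
    fix t
    have "(\<lambda>n. r ^ n * t) \<longlonglongrightarrow> 0"
      using M.r_pos M.r_less_1 by (intro tendsto_mult_left_zero LIMSEQ_realpow_zero) auto
    then have "(\<lambda>n. cmod (char M (r ^ n * t) - char N (r ^ n * t))) \<longlonglongrightarrow> cmod (char M 0 - char N 0)"
      by (intro tendsto_intros isCont_tendsto_compose[OF M.isCont_char]
          isCont_tendsto_compose[OF N.isCont_char])
    then have "cmod (char M t - char N t) \<le> 0"
      using iter by (intro LIMSEQ_le_const) (auto simp: M.char_zero N.char_zero)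
    then show "char M t = char N t" by simp
  qed
qed

context self_similar
begin

text \<open>
  Choose \<open>R\<close> such that every \<open>f\<^sub>j\<close> maps \<open>[-R, R]\<close> into itself. A point at distance more than \<open>t\<close>
  from this interval has its preimages at distance more than \<open>t / r\<close>, so the tail beyond \<open>R + t\<close> is
  at most the tail beyond \<open>R + t / r\<close>; iterating pushes it to infinity.
\<close>

lemma bounded_support: "bounded (measure_support \<mu>)"
proof -
  define D where "D = Max ((\<lambda>j. \<bar>d j\<bar>) ` {1..l})"
  have D: "\<bar>d j\<bar> \<le> D" if "j \<in> {1..l}" for j
    unfolding D_def using that by (intro Max_ge) auto
  define R where "R = D / (1 - r)"
  have "R * (1 - r) = D" using r_less_1 by (simp add: R_def)
  then have DR: "D = R - r * R" by (simp add: algebra_simps)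
  define u where "u t = prob {x. R + t < \<bar>x\<bar>}" for t
  have step: "u t \<le> u (t / r)" for t
  proof -
    have "u t = (\<Sum>j=1..l. 1 / real l * prob (ifs_map r d j -` {x. R + t < \<bar>x\<bar>}))"
      unfolding u_def by (rule prob_eq_sum) measurable
    also have "\<dots> \<le> (\<Sum>j=1..l. 1 / real l * u (t / r))"
    proof (intro sum_mono mult_left_mono)
      fix j assume j: "j \<in> {1..l}"
      have "R + t / r < \<bar>x\<bar>" if "R + t < \<bar>r * x + d j\<bar>" for x
      proof -
        have "\<bar>r * x + d j\<bar> \<le> r * \<bar>x\<bar> + D"
          using D[OF j] abs_triangle_ineq[of "r * x" "d j"] r_pos by (simp add: abs_mult)
        then have "r * R + t < r * \<bar>x\<bar>" using that DR by linarith
        then show ?thesis using r_pos by (simp add: field_simps)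
      qed
      then show "prob (ifs_map r d j -` {x. R + t < \<bar>x\<bar>}) \<le> u (t / r)"
        unfolding u_def by (intro finite_measure_mono) (auto simp: ifs_map_def)
    qed simp
    also have "\<dots> = u (t / r)" using l_pos by simp
    finally show ?thesis .
  qed
  have iter: "u 1 \<le> u (1 / r ^ n)" for n
  proof (induction n)
    case (Suc n)
    also have "u (1 / r ^ n) \<le> u (1 / r ^ Suc n)"
      using step[of "1 / r ^ n"] by (simp add: mult.commute)
    finally show ?case .
  qed simp
  have "(\<lambda>n. u (1 / r ^ n)) \<longlonglongrightarrow> prob (\<Inter>n. {x. R + 1 / r ^ n < \<bar>x\<bar>})"
    unfolding u_def
  proof (rule finite_Lim_measure_decseq)
    show "decseq (\<lambda>n. {x. R + 1 / r ^ n < \<bar>x\<bar>})"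
    proof (intro decseq_SucI subsetI CollectI)
      fix n x assume "x \<in> {x. R + 1 / r ^ Suc n < \<bar>x\<bar>}"
      moreover have "1 / r ^ n \<le> 1 / r ^ Suc n"
        using r_pos r_less_1 by (intro divide_left_mono) (auto simp: mult_left_le_one_le)
      ultimately show "R + 1 / r ^ n < \<bar>x\<bar>" by simp
    qed
  qed auto
  moreover have "(\<Inter>n. {x. R + 1 / r ^ n < \<bar>x\<bar>}) = {}"
  proof (intro equals0I)
    fix x assume x: "x \<in> (\<Inter>n. {x. R + 1 / r ^ n < \<bar>x\<bar>})"
    obtain n where "\<bar>x\<bar> - R < (1 / r) ^ n"
      using real_arch_pow[of "1 / r"] r_pos r_less_1 by auto
    moreover have "R + 1 / r ^ n < \<bar>x\<bar>" using x by auto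
    ultimately show False by (simp add: power_divide)
  qed
  ultimately have "u 1 \<le> 0"
    using iter by (intro LIMSEQ_le_const) auto
  then have "emeasure \<mu> {x. R + 1 < \<bar>x\<bar>} = 0"
    by (simp add: u_def emeasure_eq_measure measure_le_0_iff)
  moreover have "open {x. R + 1 < \<bar>x\<bar>}"
    by (intro open_Collect_less continuous_intros)
  ultimately have "{x. R + 1 < \<bar>x\<bar>} \<inter> measure_support \<mu> = {}"
    by (rule disjnt_measure_support[rotated])
  then show ?thesis
    by (intro boundedI[of _ "R + 1"]) (auto simp: not_less[symmetric])
qed

lemma compact_support: "compact (measure_support \<mu>)"
  using bounded_support closed_measure_support by (simp add: compact_eq_bounded_closed)

text \<open>
  A set is null exactly when its preimages under all the \<open>f\<^sub>j\<close> are null, and the maps are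
  homeomorphisms, so both inclusions can be read off from null neighbourhoods.
\<close>

lemma support_eq_Union: "measure_support \<mu> = (\<Union>j\<in>{1..l}. ifs_map r d j ` measure_support \<mu>)"
proof (intro equalityI subsetI)
  fix x assume x: "x \<in> measure_support \<mu>"
  show "x \<in> (\<Union>j\<in>{1..l}. ifs_map r d j ` measure_support \<mu>)"
  proof (rule ccontr)
    assume *: "\<not> ?thesis"
    have "\<exists>U. open U \<and> x \<in> U \<and> prob (ifs_map r d j -` U) = 0" if j: "j \<in> {1..l}" for j
    proof -
      \<comment> \<open>The preimage of \<open>x\<close> under \<open>f\<^sub>j\<close> lies outside the support; a null neighbourhood of it
        is carried by \<open>f\<^sub>j\<close> to a neighbourhood of \<open>x\<close>.\<close>
      define y where "y = (x - d j) / r"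
      have "ifs_map r d j y = x" using r_pos by (simp add: y_def ifs_map_def)
      then have "y \<notin> measure_support \<mu>" using * j by blast
      then obtain V where V: "open V" "y \<in> V" "emeasure \<mu> V = 0"
        by (auto simp: measure_support_def zero_less_iff_neq_zero)
      let ?U = "(\<lambda>z. (z - d j) / r) -` V"
      have "ifs_map r d j -` ?U = V" using r_pos by (auto simp: ifs_map_def)
      moreover have "open ?U" using r_pos
        by (intro open_vimage V continuous_intros) auto
      ultimately show ?thesis using V by (intro exI[of _ ?U]) (auto simp: y_def measure_def)
    qed
    then obtain U where U: "\<And>j. j \<in> {1..l} \<Longrightarrow> open (U j) \<and> x \<in> U j \<and> prob (ifs_map r d j -` U j) = 0"
      by metis
    let ?W = "\<Inter>j\<in>{1..l}. U j"
    have W: "open ?W" "x \<in> ?W" using U l_pos by (auto intro!: open_INT)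
    have "prob ?W = 0"
    proof (subst prob_eq_0_iff)
      show "\<forall>j\<in>{1..l}. prob (ifs_map r d j -` ?W) = 0"
      proof
        fix j assume j: "j \<in> {1..l}"
        have "prob (ifs_map r d j -` ?W) \<le> prob (ifs_map r d j -` U j)"
          using U[OF j] j by (intro finite_measure_mono) auto
        then show "prob (ifs_map r d j -` ?W) = 0"
          using U[OF j] by (simp add: measure_le_0_iff)
      qed
    qed (use W in auto)
    then show False using W x by (auto simp: measure_support_def emeasure_eq_measure)
  qed
next
  fix x assume "x \<in> (\<Union>j\<in>{1..l}. ifs_map r d j ` measure_support \<mu>)"
  then obtain j y where j: "j \<in> {1..l}" and y: "y \<in> measure_support \<mu>" and x: "x = ifs_map r d j y"
    by blast
  show "x \<in> measure_support \<mu>"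
    unfolding measure_support_def
  proof safe
    fix U assume U: "open U" "x \<in> U"
    have "open (ifs_map r d j -` U)"
      by (intro open_vimage U) (auto simp: ifs_map_def[abs_def] intro!: continuous_intros)
    then have "prob (ifs_map r d j -` U) \<noteq> 0"
      using y U x by (auto simp: measure_support_def emeasure_eq_measure)
    then show "0 < emeasure \<mu> U"
      using prob_eq_0_iff[of U] j U by (auto simp: emeasure_eq_measure zero_less_measure_iff)
  qed
qed

lemma support_nonempty: "measure_support \<mu> \<noteq> {}"
proof
  assume "measure_support \<mu> = {}"
  then have "AE x in \<mu>. False" using AE_in_measure_support[of \<mu>] by simp
  then show False using AE_False by blast
qed

end

section \<open>Lebesgue measure of the attractor\<close>

text \<open>
  \<open>K \<inter> E\<close> is covered by the sets \<open>f\<^sub>j(K) \<inter> E\<close>, and \<open>f\<^sub>j\<close> scales Lebesgue measure by \<open>r\<close>. With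
  \<open>E\<close> the whole line this gives \<open>r l \<ge> 1\<close>; for general \<open>E\<close> it is half of the self-similarity
  equation of the uniform measure on \<open>K\<close>.
\<close>

lemma measure_Int_attractor_le:
  assumes r: "0 < r" and K: "compact K" "K = (\<Union>j\<in>{1..l}. ifs_map r d j ` K)"
    and [measurable]: "E \<in> sets borel"
  shows "measure lborel (K \<inter> E) \<le> (\<Sum>j=1..l. r * measure lborel (K \<inter> ifs_map r d j -` E))"
proof -
  have [measurable]: "ifs_map r d j ` K \<in> sets borel" for j
    using K(1) unfolding ifs_map_def[abs_def]
    by (intro borel_compact compact_continuous_image continuous_intros)
  have piece: "measure lborel (ifs_map r d j ` K \<inter> E) = r * measure lborel (K \<inter> ifs_map r d j -` E)" for j
  proof -
    have "ifs_map r d j -` (ifs_map r d j ` K \<inter> E) = K \<inter> ifs_map r d j -` E"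
      using r by (auto simp: ifs_map_def)
    then show ?thesis
      using emeasure_lborel_vimage_ifs_map[OF r, of "ifs_map r d j ` K \<inter> E" d j] r
      by (simp add: measure_def enn2real_mult)
  qed
  have "K \<inter> E = (\<Union>j\<in>{1..l}. ifs_map r d j ` K \<inter> E)"
    using K(2) by blast
  also have "measure lborel \<dots> \<le> (\<Sum>j=1..l. measure lborel (ifs_map r d j ` K \<inter> E))"
    by (rule measure_UNION_le) auto
  finally show ?thesis by (simp only: piece)
qed

lemma attractor_ratio_ge:
  assumes "0 < r" "compact K" "K = (\<Union>j\<in>{1..l}. ifs_map r d j ` K)"
    and "0 < measure lborel K"
  shows "1 \<le> r * real l"
proof -
  have "measure lborel K * 1 \<le> measure lborel K * (r * real l)"
    using measure_Int_attractor_le[OF assms(1-3), of UNIV] by (simp add: mult_ac)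
  then show ?thesis using assms(4) by (simp only: mult_le_cancel_left_pos)
qed

text \<open>
  The covering inequality holds for \<open>E\<close> and for its complement. For \<open>r = 1 / l\<close> the two left sides
  and the two right sides both add up to the measure of \<open>K\<close>, so both inequalities are equalities.
\<close>

proposition self_similar_measure_uniform:
  assumes l: "1 \<le> l" and r: "r = 1 / real l"
    and K: "compact K" "K = (\<Union>j\<in>{1..l}. ifs_map r d j ` K)" and pos: "0 < measure lborel K"
  shows "self_similar_measure l r d (uniform_measure lborel K)"
  unfolding self_similar_measure_def
proof (intro conjI ballI)
  have r0: "0 < r" using l r by simp
  have Kb[measurable]: "K \<in> sets borel" using K(1) by (rule borel_compact)
  have fin: "emeasure lborel K \<noteq> \<infinity>" using emeasure_compact_finite[OF K(1)] by simp
  have em: "emeasure lborel K \<noteq> 0" using pos by (auto simp: measure_def)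
  have fm: "K \<inter> X \<in> fmeasurable lborel" if "X \<in> sets borel" for X
    using that by (intro fmeasurable_Int_fmeasurable fmeasurable_compact K(1)) auto
  show "prob_space (uniform_measure lborel K)"
    using em fin by (rule prob_space_uniform_measure)
  show "sets (uniform_measure lborel K) = sets borel" by simp
  fix E :: "real set" assume E[measurable]: "E \<in> sets borel"
  let ?m = "\<lambda>X. measure lborel (K \<inter> X)" and ?s = "\<lambda>X. \<Sum>j=1..l. r * measure lborel (K \<inter> ifs_map r d j -` X)"
  have split: "?m X + ?m (- X) = measure lborel K" if "X \<in> sets borel" for X
  proof -
    have "?m X + ?m (- X) = measure lborel (K \<inter> X \<union> K \<inter> - X)"
      using that fmeasurableD2[OF fm[of X]] fmeasurableD2[OF fm[of "- X"]]
      by (intro measure_Union[symmetric]) auto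
    also have "K \<inter> X \<union> K \<inter> - X = K" by blast
    finally show ?thesis .
  qed
  have "?s E + ?s (- E) = (\<Sum>j=1..l. r * (?m (ifs_map r d j -` E) + ?m (- (ifs_map r d j -` E))))"
    by (simp add: sum.distrib algebra_simps vimage_Compl)
  also have "\<dots> = measure lborel K"
    using l by (subst split) (auto simp: r)
  finally have "?s E + ?s (- E) = ?m E + ?m (- E)"
    using split[OF E] by simp
  moreover have "?m E \<le> ?s E" "?m (- E) \<le> ?s (- E)"
    by (intro measure_Int_attractor_le r0 K; measurable)+
  ultimately have "?m E = ?s E" by linarith
  then show "measure (uniform_measure lborel K) E =
      (\<Sum>j=1..l. 1 / real l * measure (uniform_measure lborel K) (ifs_map r d j -` E))"
    using em fin by (simp add: measure_uniform_measure r sum_divide_distrib)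
qed

section \<open>The left end point and the contraction ratio\<close>

context self_similar
begin

text \<open>
  The map with the smallest translation fixes the left end point \<open>a\<close> of the support. By injectivity of
  \<open>d\<close> there is a gap \<open>\<delta>\<close> to the next translation, so the other pieces of the support do not
  reach below \<open>a + \<delta>\<close>, where only one term of the self-similarity equation survives.
\<close>

lemma leftmost_piece:
  assumes "inj_on d {1..l}"
  obtains a i \<delta> where "a \<in> measure_support \<mu>" "0 < \<delta>" "ifs_map r d i a = a"
    "\<And>E. E \<in> sets borel \<Longrightarrow> E \<subseteq> {..<a + \<delta>} \<Longrightarrow> prob E = 1 / real l * prob (ifs_map r d i -` E)"
proof -
  let ?K = "measure_support \<mu>"
  obtain a where a: "a \<in> ?K" and a_min: "\<And>x. x \<in> ?K \<Longrightarrow> a \<le> x"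
    using compact_attains_inf[OF compact_support support_nonempty] by blast
  have "Min (d ` {1..l}) \<in> d ` {1..l}" using l_pos by (intro Min_in) auto
  then obtain i where i: "i \<in> {1..l}" and "d i = Min (d ` {1..l})" by auto
  then have i_min: "d i \<le> d j" if "j \<in> {1..l}" for j using that by simp
  have i_less: "d i < d j" if "j \<in> {1..l} - {i}" for j
  proof -
    have "d i \<noteq> d j" using inj_onD[OF assms, of i j] that i by auto
    then show ?thesis using i_min[of j] that by simp
  qed
  \<comment> \<open>Inserting \<open>1\<close> keeps the set nonempty when there is only one map.\<close>
  define \<delta> where "\<delta> = Min (insert 1 ((\<lambda>j. d j - d i) ` ({1..l} - {i})))"
  have \<delta>: "0 < \<delta>" unfolding \<delta>_def using i_less by (subst Min_gr_iff) auto
  have \<delta>_le: "\<delta> \<le> d j - d i" if "j \<in> {1..l} - {i}" for j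
    unfolding \<delta>_def using that by (intro Min_le) auto
  obtain j y where "j \<in> {1..l}" "y \<in> ?K" "a = ifs_map r d j y"
    using a support_eq_Union by blast
  then have "ifs_map r d i a \<le> a"
    using r_pos i_min[of j] a_min[of y] by (simp add: ifs_map_def add_mono)
  moreover have "a \<le> ifs_map r d i a"
    using a i support_eq_Union by (intro a_min) blast
  ultimately have fix_a: "ifs_map r d i a = a" by simp
  have "AE x in \<mu>. x \<notin> {..<a}"
    using AE_in_measure_support[of \<mu>] by (auto elim!: eventually_mono dest: a_min)
  then have left_null: "prob {..<a} = 0"
    by (subst prob_eq_0) auto
  have "prob E = 1 / real l * prob (ifs_map r d i -` E)"
    if E: "E \<in> sets borel" "E \<subseteq> {..<a + \<delta>}" for E
  proof -
    have "prob (ifs_map r d j -` E) = 0" if j: "j \<in> {1..l} - {i}" for j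
    proof -
      have "ifs_map r d j -` E \<subseteq> {..<a}"
      proof
        fix x assume "x \<in> ifs_map r d j -` E"
        then have "r * x + d j < a + \<delta>" using E by (auto simp: ifs_map_def)
        then have "r * x < r * a" using fix_a \<delta>_le[OF j] by (simp add: ifs_map_def)
        then show "x \<in> {..<a}" using r_pos by simp
      qed
      then have "prob (ifs_map r d j -` E) \<le> prob {..<a}"
        by (intro finite_measure_mono) auto
      then show ?thesis using left_null by (simp add: measure_le_0_iff)
    qed
    then show ?thesis
      unfolding prob_eq_sum[OF E(1)] by (subst sum.remove[OF _ i]) (auto intro!: sum.neutral)
  qed
  then show ?thesis using a \<delta> fix_a that by blast
qed

text \<open>
  Let \<open>J n\<close> be the half-line left of \<open>a + r\<^sup>n \<delta>\<close>. It has \<open>\<mu>\<close>-measure \<open>l\<^sup>-\<^sup>n \<mu>(J 0)\<close>. The set where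
  \<open>g > 0\<close> is, up to null sets, carried into itself by the leftmost map, so it occupies Lebesgue
  measure \<open>v n \<ge> r\<^sup>n v 0\<close> in \<open>J n\<close>. As \<open>g \<ge> q\<close> there, \<open>q r\<^sup>n v 0 \<le> l\<^sup>-\<^sup>n \<mu>(J 0)\<close> for all \<open>n\<close>,
  which bounds the powers of \<open>r l\<close>.
\<close>

proposition ratio_le_if_density_bounded_below:
  fixes g :: "real \<Rightarrow> real"
  assumes inj: "inj_on d {1..l}"
    and dens: "\<mu> = density lborel (\<lambda>x. ennreal (g x))"
    and [measurable]: "g \<in> borel_measurable borel"
    and q: "0 < q" "AE x in lborel. g x = 0 \<or> q \<le> g x"
  shows "r * real l \<le> 1"
proof -
  obtain a i \<delta> where a: "a \<in> measure_support \<mu>" and \<delta>: "0 < \<delta>" and fix_a: "ifs_map r d i a = a"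
    and near: "\<And>E. E \<in> sets borel \<Longrightarrow> E \<subseteq> {..<a + \<delta>} \<Longrightarrow>
      prob E = 1 / real l * prob (ifs_map r d i -` E)"
    by (rule leftmost_piece[OF inj]) (rule that)
  have null_iff: "prob E = 0 \<longleftrightarrow> (AE x in lborel. x \<in> E \<longrightarrow> g x \<le> 0)" if "E \<in> sets borel" for E
  proof -
    have "prob E = 0 \<longleftrightarrow> E \<in> null_sets (density lborel (\<lambda>x. ennreal (g x)))"
      using that by (simp add: null_sets_def emeasure_eq_measure flip: dens)
    also have "\<dots> \<longleftrightarrow> (AE x in lborel. x \<in> E \<longrightarrow> g x \<le> 0)"
      using that by (subst null_sets_density_iff) (auto simp: ennreal_eq_0_iff)
    finally show ?thesis .
  qed
  define J where "J n = {..<a + r ^ n * \<delta>}" for n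
  define v where "v n = emeasure lborel {x \<in> J n. 0 < g x}" for n
  have [measurable]: "J n \<in> sets borel" for n by (simp add: J_def)
  have J_sub: "J n \<subseteq> {..<a + \<delta>}" for n
  proof -
    have "r ^ n * \<delta> \<le> \<delta>" using \<delta> r_pos r_less_1 by (simp add: power_le_one mult_left_le_one_le)
    then show ?thesis by (auto simp: J_def)
  qed
  have J_vimage: "ifs_map r d i x \<in> J (Suc n) \<longleftrightarrow> x \<in> J n" for n x
  proof -
    have "ifs_map r d i x = a + r * (x - a)"
      using fix_a by (simp add: ifs_map_def algebra_simps)
    then have "ifs_map r d i x \<in> J (Suc n) \<longleftrightarrow> r * (x - a) < r * (r ^ n * \<delta>)"
      by (simp add: J_def mult.assoc)
    also have "\<dots> \<longleftrightarrow> x \<in> J n"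
      using r_pos by (auto simp: J_def)
    finally show ?thesis .
  qed
  have prob_J: "prob (J n) = (1 / real l) ^ n * prob (J 0)" for n
  proof (induction n)
    case (Suc n)
    have "ifs_map r d i -` J (Suc n) = J n" using J_vimage by auto
    then show ?case using near[OF _ J_sub[of "Suc n"]] Suc by simp
  qed simp
  have v_Suc: "ennreal r * v n \<le> v (Suc n)" for n
  proof -
    \<comment> \<open>The part of \<open>J (Suc n)\<close> where \<open>g\<close> vanishes is \<open>\<mu>\<close>-null, hence so is its preimage; thus
      almost every point of \<open>J n\<close> with \<open>g > 0\<close> is mapped to a point with \<open>g > 0\<close>.\<close>
    let ?Z = "{x \<in> J (Suc n). g x \<le> 0}"
    have "prob ?Z = 0" by (subst null_iff) auto
    then have "prob (ifs_map r d i -` ?Z) = 0"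
      using near[of ?Z] J_sub[of "Suc n"] l_pos by auto
    then have "AE x in lborel. x \<in> ifs_map r d i -` ?Z \<longrightarrow> g x \<le> 0"
      by (subst (asm) null_iff) auto
    then have "v n \<le> emeasure lborel (ifs_map r d i -` {x \<in> J (Suc n). 0 < g x})"
      unfolding v_def by (intro emeasure_mono_AE) (auto simp: J_vimage elim!: eventually_mono)
    then have "ennreal r * v n \<le> ennreal r * emeasure lborel (ifs_map r d i -` {x \<in> J (Suc n). 0 < g x})"
      by (rule mult_left_mono) simp
    also have "\<dots> = v (Suc n)"
      unfolding v_def by (rule emeasure_lborel_vimage_ifs_map[symmetric]) (auto simp: r_pos)
    finally show ?thesis .
  qed
  have v_ge: "ennreal (r ^ n) * v 0 \<le> v n" for n
  proof (induction n)
    case (Suc n)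
    have "ennreal (r ^ Suc n) * v 0 = ennreal r * (ennreal (r ^ n) * v 0)"
      using r_pos by (simp add: ennreal_mult mult.assoc)
    also have "\<dots> \<le> ennreal r * v n" by (intro mult_left_mono Suc.IH) simp
    also note v_Suc
    finally show ?case .
  qed simp
  have v_le: "ennreal q * v n \<le> prob (J n)" for n
  proof -
    have "ennreal q * v n = (\<integral>\<^sup>+x\<in>{x \<in> J n. 0 < g x}. ennreal q \<partial>lborel)"
      by (simp add: v_def nn_integral_cmult)
    also have "\<dots> \<le> (\<integral>\<^sup>+x\<in>J n. ennreal (g x) \<partial>lborel)"
      using q(2) by (intro nn_integral_mono_AE) (auto elim!: eventually_mono simp: indicator_def ennreal_leI)
    also have "\<dots> = emeasure (density lborel (\<lambda>x. ennreal (g x))) (J n)"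
      by (simp add: emeasure_density)
    also have "\<dots> = prob (J n)" by (simp add: emeasure_eq_measure flip: dens)
    finally show ?thesis .
  qed
  have v0_fin: "v 0 \<noteq> top"
    using v_le[of 0] q(1) by (auto simp: ennreal_mult_top top_unique)
  have "open (J 0)" "a \<in> J 0" using \<delta> by (auto simp: J_def)
  have "prob (J 0) \<noteq> 0"
    using a \<open>open (J 0)\<close> \<open>a \<in> J 0\<close> by (auto simp: measure_support_def emeasure_eq_measure)
  have v0_pos: "v 0 \<noteq> 0"
  proof
    assume "v 0 = 0"
    then have "AE x in lborel. \<not> (x \<in> J 0 \<and> 0 < g x)"
      unfolding v_def by (subst AE_iff_measurable[OF _ refl]) auto
    then have "AE x in lborel. x \<in> J 0 \<longrightarrow> g x \<le> 0"
      by eventually_elim (simp add: not_less)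
    then have "prob (J 0) = 0"
      by (simp only: null_iff[OF \<open>J 0 \<in> sets borel\<close>])
    with \<open>prob (J 0) \<noteq> 0\<close> show False ..
  qed
  define w where "w = enn2real (v 0)"
  have w: "v 0 = ennreal w" "0 < w"
    using v0_fin v0_pos by (auto simp: w_def enn2real_positive_iff less_top zero_less_iff_neq_zero)
  have bound: "(r * real l) ^ n \<le> prob (J 0) / (q * w)" for n
  proof -
    have "ennreal (q * (r ^ n * w)) = ennreal q * (ennreal (r ^ n) * v 0)"
      using q r_pos w by (simp add: ennreal_mult)
    also have "\<dots> \<le> ennreal q * v n" by (intro mult_left_mono v_ge) simp
    also note v_le
    finally have "q * (r ^ n * w) \<le> prob (J n)"
      by simp
    also note prob_J
    finally have "q * (r ^ n * w) \<le> (1 / real l) ^ n * prob (J 0)" .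
    then have "real l ^ n * (q * (r ^ n * w)) \<le> real l ^ n * ((1 / real l) ^ n * prob (J 0))"
      by (intro mult_left_mono) auto
    also have "\<dots> = prob (J 0)" using l_pos by (simp add: power_one_over)
    finally have "(r * real l) ^ n * (q * w) \<le> prob (J 0)"
      by (simp add: power_mult_distrib mult_ac)
    then show ?thesis using q w by (simp add: pos_le_divide_eq)
  qed
  show ?thesis
  proof (rule ccontr)
    assume "\<not> ?thesis"
    then obtain n where "prob (J 0) / (q * w) < (r * real l) ^ n"
      using real_arch_pow[of "r * real l"] by auto
    with bound[of n] show False by simp
  qed
qed

end

section \<open>Fourier frames force uniformity\<close>

theorem theorem1p2:
  fixes l :: nat and r :: real and d :: "nat \<Rightarrow> real"
    and \<mu> :: "real measure" and K :: "real set"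
  assumes "l \<ge> 2" and "0 < r" and "r < 1"
    and "inj_on d {1..l}"
    and "self_similar_measure l r d \<mu>"
    and "K = measure_support \<mu>"
    and "absolutely_continuous lborel \<mu>"
    and "admits_fourier_frame (restrict_space \<mu> K)"
  shows "r = 1 / real l \<and> self_similar_tile l r d K \<and>
    \<mu> = density lborel (\<lambda>x. ennreal (1 / measure lborel K * indicator K x))"
proof -
  interpret self_similar l r d \<mu>
    using assms(1,2,3,5) by unfold_locales auto
  have K: "compact K" "K = (\<Union>j\<in>{1..l}. ifs_map r d j ` K)"
    using compact_support support_eq_Union by (simp_all add: \<open>K = measure_support \<mu>\<close>)
  have K_borel[measurable]: "K \<in> sets borel" using K(1) by (rule borel_compact)
  have AE_K: "AE x in \<mu>. x \<in> K"
    using AE_in_measure_support[of \<mu>] by (simp add: \<open>K = measure_support \<mu>\<close>)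

  obtain g where g[measurable]: "g \<in> borel_measurable borel" and g0: "\<And>x. 0 \<le> g x"
    and dens: "\<mu> = density lborel (\<lambda>x. ennreal (g x))"
  proof -
    obtain g where g: "g \<in> borel_measurable lborel"
      "AE x in lborel. RN_deriv lborel \<mu> x = ennreal (g x)" "\<And>x. 0 \<le> g x"
      using sigma_finite_measure.real_RN_deriv[OF sigma_finite_lborel finite_measure_axioms assms(7)]
      by auto
    have "\<mu> = density lborel (RN_deriv lborel \<mu>)"
      using sigma_finite_measure.density_RN_deriv[OF sigma_finite_lborel assms(7)] by simp
    also have "\<dots> = density lborel (\<lambda>x. ennreal (g x))"
      using g by (intro density_cong) auto
    finally show ?thesis using g that by auto
  qed
  obtain \<Lambda> A B where "frame_bounds \<mu> \<Lambda> A B"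
    using admits_fourier_frame_restrict_space[OF assms(8) _ K_borel AE_K] by auto
  then obtain q where "0 < q" "AE x in lborel. g x = 0 \<or> q \<le> g x"
    using frame_density_bounded_below[of g] prob_space_axioms g g0 unfolding dens by metis
  then have "r * real l \<le> 1"
    by (rule ratio_le_if_density_bounded_below[OF assms(4) dens g])

  have fin: "emeasure lborel K < \<infinity>" by (rule emeasure_compact_finite[OF K(1)])
  have pos: "0 < measure lborel K"
  proof (rule ccontr)
    assume "\<not> ?thesis"
    then have "K \<in> null_sets lborel"
      using fin by (auto simp: null_sets_def emeasure_eq_ennreal_measure zero_less_measure_iff)
    then have "K \<in> null_sets \<mu>"
      using assms(7) by (auto simp: absolutely_continuous_def)
    then have "AE x in \<mu>. x \<notin> K" by (rule AE_not_in)
    with AE_K have "AE x in \<mu>. False" by eventually_elim simp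
    then show False using AE_False by blast
  qed
  have "1 \<le> r * real l" by (rule attractor_ratio_ge[OF assms(2) K pos])
  with \<open>r * real l \<le> 1\<close> have r: "r = 1 / real l"
    using l_pos by (simp add: field_simps)

  have em: "emeasure lborel K = ennreal (measure lborel K)"
    using fin by (intro emeasure_eq_ennreal_measure) auto
  have "self_similar l r d (uniform_measure lborel K)"
    using l_pos r_pos r_less_1 self_similar_measure_uniform[OF l_pos r K pos]
    by unfold_locales
  then have "\<mu> = uniform_measure lborel K"
    using self_similar_axioms self_similar_measure_unique by blast
  also have "\<dots> = density lborel (\<lambda>x. ennreal (1 / measure lborel K * indicator K x))"
    unfolding uniform_measure_def em using pos
    by (intro arg_cong[where f="density lborel"] ext)
       (auto simp: indicator_def divide_ennreal ennreal_1[symmetric] simp del: ennreal_1)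
  finally have "\<mu> = density lborel (\<lambda>x. ennreal (1 / measure lborel K * indicator K x))" .
  then show ?thesis
    using r K pos em by (simp add: self_similar_tile_def)
qed

end
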